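(* Let $\mathcal{T}=(t_{ijkl})\in\widehat{\mathcal{E}}_{4,3}$. Call a permutation $(i,j,k)$ of $(1,2,3)$ admissible if $$t_{iiij}t_{ijjj}=t_{jjjk}t_{jkkk}=t_{iiik}t_{ikkk}=t_{iiik}+t_{ikkk}=0,\qquad t_{iiij}+t_{ijjj}\neq0,\qquad t_{jjjk}+t_{jkkk}\neq0,$$ and suppose that an admissible permutation exists. Then $\mathcal{T}$ is positive definite if and only if there is an admissible permutation $(i,j,k)$ for which one of the following conditions is satisfied. (a) $t_{iiij},t_{jkkk}\in\{-1,1\}$, and one of: (a$_1$) $t_{1123}=t_{1223}=t_{1233}=0$, $t_{iikk}\in\{0,1\}$ and $t_{iijj}=t_{jjkk}=1$; (a$_2$) $t_{ijjk}\in\{-1,1\}$, $t_{iijk}=t_{ijkk}=0$ and $t_{1122}=t_{2233}=t_{1133}=1$; (a$_3$) $t_{1122}=t_{2233}=t_{1133}=-t_{iiij}t_{jkkk}t_{ijjk}=1$, and either $t_{iijk}t_{jkkk}=-1$ with $t_{ijkk}=0$, or $t_{ijkk}t_{iiij}=-1$ with $t_{iijk}=0$. (b) $t_{iiij},t_{jjjk}\in\{-1,1\}$, and one of: (b$_1$) $t_{1123}=t_{1223}=t_{1233}=0$, $t_{iikk}\in\{0,1\}$ and $t_{iijj}=t_{jjkk}=1$; (b$_2$) $t_{ijkk}\in\{-1,1\}$, $t_{iijk}=t_{ijjk}=0$ and $t_{1122}=t_{2233}=t_{1133}=1$; (b$_3$) $t_{1122}=t_{2233}=t_{1133}=-t_{iiij}t_{jjjk}t_{ijjk}=-t_{ijkk}t_{iiij}=1$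 and $t_{iijk}=0$. (c) $t_{ijjj},t_{jjjk}\in\{-1,1\}$, $t_{ijjj}t_{jjjk}t_{ijjk}=1$, and one of: (c$_1$) $t_{ijjj}t_{ijkk}=t_{jjjk}t_{iijk}=t_{1122}=t_{2233}=t_{1133}=1$; (c$_2$) $t_{iijk}=t_{ijkk}=0$, $t_{iikk}\in\{0,1\}$ and $t_{iijj}=t_{jjkk}=1$.
   Context: A 4th order 3-dimensional real tensor $\mathcal{T}=(t_{ijkl})_{i,j,k,l\in\{1,2,3\}}$ is symmetric if its entries are invariant under all permutations of the four indices (so, e.g., $t_{ijjk}$ denotes the common value of all entries whose index multiset is $\{i,j,j,k\}$). $\widehat{\mathcal{E}}_{4,3}$ is the set of symmetric 4th order 3-dimensional tensors all of whose entries lie in $\{-1,0,1\}$ and whose diagonal entries satisfy $t_{1111}=t_{2222}=t_{3333}=1$. For $x\in\mathbb{R}^3$ put $\mathcal{T}x^4=\sum_{i,j,k,l=1}^3 t_{ijkl}x_ix_jx_kx_l$. $\mathcal{T}$ is positive definite if $\mathcal{T}x^4>0$ for all $x\in\mathbb{R}^3\setminus\{0\}$. *)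

theory Defs
  imports "HOL-Analysis.Analysis" "HOL-Library.Multiset"
begin

text \<open>
  The index set is the three-element type \<^typ>\<open>3\<close>, so that vectors live in \<^typ>\<open>real ^ 3\<close>.
  Its elements are 1, 2 and 3 (where 3 = 0 in this type).
\<close>

type_synonym tensor43 = "3 \<Rightarrow> 3 \<Rightarrow> 3 \<Rightarrow> 3 \<Rightarrow> real"

text \<open>Two index lists have the same multiset iff they are permutations of each other.\<close>

definition symmetric_tensor :: "tensor43 \<Rightarrow> bool" where
  "symmetric_tensor t \<longleftrightarrow>
     (\<forall>i j k l i' j' k' l'. mset [i, j, k, l] = mset [i', j', k', l']
        \<longrightarrow> t i j k l = t i' j' k' l')"

definition E_hat_43 :: "tensor43 set" where
  "E_hat_43 = {t. symmetric_tensor t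
     \<and> (\<forall>i j k l. t i j k l \<in> {-1, 0, 1})
     \<and> t 1 1 1 1 = 1 \<and> t 2 2 2 2 = 1 \<and> t 3 3 3 3 = 1}"

definition tensor_form :: "tensor43 \<Rightarrow> real ^ 3 \<Rightarrow> real" where
  "tensor_form t x =
     (\<Sum>i\<in>UNIV. \<Sum>j\<in>UNIV. \<Sum>k\<in>UNIV. \<Sum>l\<in>UNIV. t i j k l * x $ i * x $ j * x $ k * x $ l)"

definition positive_definite_tensor :: "tensor43 \<Rightarrow> bool" where
  "positive_definite_tensor t \<longleftrightarrow> (\<forall>x. x \<noteq> 0 \<longrightarrow> tensor_form t x > 0)"

definition admissible :: "tensor43 \<Rightarrow> 3 \<Rightarrow> 3 \<Rightarrow> 3 \<Rightarrow> bool" where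
  "admissible t i j k \<longleftrightarrow>
     mset [i, j, k] = mset [1, 2, 3]
     \<and> t i i i j * t i j j j = 0
     \<and> t j j j k * t j k k k = 0
     \<and> t i i i k * t i k k k = 0
     \<and> t i i i k + t i k k k = 0
     \<and> t i i i j + t i j j j \<noteq> 0
     \<and> t j j j k + t j k k k \<noteq> 0"

definition condition_a :: "tensor43 \<Rightarrow> 3 \<Rightarrow> 3 \<Rightarrow> 3 \<Rightarrow> bool" where
  "condition_a t i j k \<longleftrightarrow>
     t i i i j \<in> {-1, 1} \<and> t j k k k \<in> {-1, 1} \<and>
     ((t 1 1 2 3 = 0 \<and> t 1 2 2 3 = 0 \<and> t 1 2 3 3 = 0 \<and> t i i k k \<in> {0, 1}
         \<and> t i i j j = 1 \<and> t j j k k = 1)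
      \<or> (t i j j k \<in> {-1, 1} \<and> t i i j k = 0 \<and> t i j k k = 0
         \<and> t 1 1 2 2 = 1 \<and> t 2 2 3 3 = 1 \<and> t 1 1 3 3 = 1)
      \<or> (t 1 1 2 2 = 1 \<and> t 2 2 3 3 = 1 \<and> t 1 1 3 3 = 1
         \<and> - (t i i i j * t j k k k * t i j j k) = 1
         \<and> (t i i j k * t j k k k = -1 \<and> t i j k k = 0
            \<or> t i j k k * t i i i j = -1 \<and> t i i j k = 0)))"

definition condition_b :: "tensor43 \<Rightarrow> 3 \<Rightarrow> 3 \<Rightarrow> 3 \<Rightarrow> bool" where
  "condition_b t i j k \<longleftrightarrow>
     t i i i j \<in> {-1, 1} \<and> t j j j k \<in> {-1, 1} \<and>
     ((t 1 1 2 3 = 0 \<and> t 1 2 2 3 = 0 \<and> t 1 2 3 3 = 0 \<and> t i i k k \<in> {0, 1}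
         \<and> t i i j j = 1 \<and> t j j k k = 1)
      \<or> (t i j k k \<in> {-1, 1} \<and> t i i j k = 0 \<and> t i j j k = 0
         \<and> t 1 1 2 2 = 1 \<and> t 2 2 3 3 = 1 \<and> t 1 1 3 3 = 1)
      \<or> (t 1 1 2 2 = 1 \<and> t 2 2 3 3 = 1 \<and> t 1 1 3 3 = 1
         \<and> - (t i i i j * t j j j k * t i j j k) = 1
         \<and> - (t i j k k * t i i i j) = 1 \<and> t i i j k = 0))"

definition condition_c :: "tensor43 \<Rightarrow> 3 \<Rightarrow> 3 \<Rightarrow> 3 \<Rightarrow> bool" where
  "condition_c t i j k \<longleftrightarrow>
     t i j j j \<in> {-1, 1} \<and> t j j j k \<in> {-1, 1} \<and> t i j j j * t j j j k * t i j j k = 1 \<and>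
     ((t i j j j * t i j k k = 1 \<and> t j j j k * t i i j k = 1
         \<and> t 1 1 2 2 = 1 \<and> t 2 2 3 3 = 1 \<and> t 1 1 3 3 = 1)
      \<or> (t i i j k = 0 \<and> t i j k k = 0 \<and> t i i k k \<in> {0, 1}
         \<and> t i i j j = 1 \<and> t j j k k = 1))"

end

theory Submission
  imports Defs
begin

text \<open>
  For an admissible \<open>(i, j, k)\<close> the form in \<open>x = x\<^sub>i\<close>, \<open>y = x\<^sub>j\<close>, \<open>z = x\<^sub>k\<close> contains exactly one of
  \<open>x\<^sup>3y\<close>, \<open>xy\<^sup>3\<close> and exactly one of \<open>y\<^sup>3z\<close>, \<open>yz\<^sup>3\<close>. Flipping the signs of \<open>x\<close> and \<open>z\<close> makes their
  coefficients equal to 1, and exchanging \<open>x\<close> and \<open>z\<close> leaves three shapes, which are those of the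
  conditions (a), (b) and (c). Each remaining choice of the six free coefficients in \<open>{-1, 0, 1}\<close> is
  either refuted by an integer point at which the form is not positive, or is positive definite
  because the form is a sum of squares plus a positive multiple of \<open>x\<^sup>4 + y\<^sup>4 + z\<^sup>4\<close>.
\<close>

section \<open>Permutations of the indices\<close>

lemma three_perm_cases:
  fixes i j k :: 3
  assumes "mset [i, j, k] = mset [1, 2, 3]"
  obtains "i = 1" "j = 2" "k = 3" | "i = 1" "j = 3" "k = 2"
    | "i = 2" "j = 1" "k = 3" | "i = 2" "j = 3" "k = 1"
    | "i = 3" "j = 1" "k = 2" | "i = 3" "j = 2" "k = 1"
proof -
  have "{i, j, k} = {1, 2, 3}"
    using mset_eq_setD[OF assms] by simp
  then have "1 \<in> {i, j, k}" "2 \<in> {i, j, k}" "3 \<in> {i, j, k}"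
    by simp_all
  then show thesis
    using that by auto
qed

text \<open>Adjacent transpositions generate all permutations of the four positions; as permutative
  rules in ordered rewriting they bring all reorderings of an entry to one normal form.\<close>

lemma symmetric_tensor_swap:
  assumes "symmetric_tensor t"
  shows "t a b c d = t b a c d" "t a b c d = t a c b d" "t a b c d = t a b d c"
  using assms unfolding symmetric_tensor_def by (metis add_mset_commute mset.simps(2))+

section \<open>The ternary quartic of an admissible permutation\<close>

text \<open>The factors 4, 6 and 12 are multinomial coefficients. The monomials
  \<open>x^3 * z\<close> and \<open>x * z^3\<close> are absent because admissibility makes both the
  product and the sum of \<open>t i i i k\<close> and \<open>t i k k k\<close> vanish, hence both
  entries.\<close>

definition quartic_form ::
  "real \<Rightarrow> real \<Rightarrow> real \<Rightarrow> real \<Rightarrow> real \<Rightarrow> real \<Rightarrow> real \<Rightarrow> real \<Rightarrow> real \<Rightarrow> real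
    \<Rightarrow> real \<Rightarrow> real \<Rightarrow> real \<Rightarrow> real" where
  "quartic_form a b c d u v w p q r x y z =
     x^4 + y^4 + z^4 + 4 * (a * x^3 * y + b * x * y^3 + c * y^3 * z + d * y * z^3)
     + 6 * (u * x^2 * y^2 + v * y^2 * z^2 + w * x^2 * z^2)
     + 12 * x * y * z * (p * x + q * y + r * z)"

definition quartic_pd where
  "quartic_pd a b c d u v w p q r \<longleftrightarrow>
     (\<forall>x y z. (x, y, z) \<noteq> (0, 0, 0) \<longrightarrow> quartic_form a b c d u v w p q r x y z > 0)"

lemma E_hat_43_diag:
  assumes "t \<in> E_hat_43"
  shows "t i i i i = 1"
  using assms exhaust_3[of i] unfolding E_hat_43_def by auto

lemma tensor_form_eq_quartic_form:
  assumes t: "t \<in> E_hat_43" and adm: "admissible t i j k"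
  shows "tensor_form t x =
    quartic_form (t i i i j) (t i j j j) (t j j j k) (t j k k k)
      (t i i j j) (t j j k k) (t i i k k) (t i i j k) (t i j j k) (t i j k k) (x $ i) (x $ j) (x $ k)"
proof -
  have sym: "symmetric_tensor t" using t by (simp add: E_hat_43_def)
  have perm: "mset [i, j, k] = mset [1, 2, 3]"
    and z: "t i i i k = 0" "t i k k k = 0"
    using adm by (auto simp: admissible_def)
  have sumUNIV: "(\<Sum>m\<in>UNIV. g m) = g i + g j + g k" for g :: "3 \<Rightarrow> real"
    using perm by (rule three_perm_cases) (simp_all add: sum_3)
  note sw = symmetric_tensor_swap[OF sym]
  have sorted: "t i i j i = t i i i j" "t i j i i = t i i i j" "t j i i i = t i i i j"
    "t j i j j = t i j j j" "t j j i j = t i j j j" "t j j j i = t i j j j"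
    "t j j k j = t j j j k" "t j k j j = t j j j k" "t k j j j = t j j j k"
    "t k j k k = t j k k k" "t k k j k = t j k k k" "t k k k j = t j k k k"
    "t i i k i = t i i i k" "t i k i i = t i i i k" "t k i i i = t i i i k"
    "t k i k k = t i k k k" "t k k i k = t i k k k" "t k k k i = t i k k k"
    "t i j i j = t i i j j" "t i j j i = t i i j j" "t j i i j = t i i j j" "t j i j i = t i i j j" "t j j i i = t i i j j"
    "t j k j k = t j j k k" "t j k k j = t j j k k" "t k j j k = t j j k k" "t k j k j = t j j k k" "t k k j j = t j j k k"
    "t i k i k = t i i k k" "t i k k i = t i i k k" "t k i i k = t i i k k" "t k i k i = t i i k k" "t k k i i = t i i k k"
    "t i i k j = t i i j k" "t i j i k = t i i j k" "t i k i j = t i i j k" "t i j k i = t i i j k" "t i k j i = t i i j k"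
    "t j i i k = t i i j k" "t k i i j = t i i j k" "t j i k i = t i i j k" "t k i j i = t i i j k" "t j k i i = t i i j k" "t k j i i = t i i j k"
    "t i j k j = t i j j k" "t i k j j = t i j j k" "t j i j k = t i j j k" "t j i k j = t i j j k" "t j j i k = t i j j k" "t j j k i = t i j j k"
    "t j k i j = t i j j k" "t j k j i = t i j j k" "t k i j j = t i j j k" "t k j i j = t i j j k" "t k j j i = t i j j k"
    "t i k j k = t i j k k" "t i k k j = t i j k k" "t j i k k = t i j k k" "t j k i k = t i j k k" "t j k k i = t i j k k"
    "t k i j k = t i j k k" "t k i k j = t i j k k" "t k j i k = t i j k k" "t k j k i = t i j k k" "t k k i j = t i j k k" "t k k j i = t i j k k"
    by (simp_all only: sw)
  show ?thesis
    unfolding tensor_form_def quartic_form_def sumUNIV sorted z E_hat_43_diag[OF t]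
    by (simp add: power4_eq_xxxx power3_eq_cube power2_eq_square algebra_simps)
qed

lemma tensor_pd_iff_quartic_pd:
  assumes t: "t \<in> E_hat_43" and adm: "admissible t i j k"
  shows "positive_definite_tensor t \<longleftrightarrow>
    quartic_pd (t i i i j) (t i j j j) (t j j j k) (t j k k k)
      (t i i j j) (t j j k k) (t i i k k) (t i i j k) (t i j j k) (t i j k k)"
proof -
  have perm: "mset [i, j, k] = mset [1, 2, 3]"
    using adm by (auto simp: admissible_def)
  have nz: "x \<noteq> 0 \<longleftrightarrow> (x $ i, x $ j, x $ k) \<noteq> (0, 0, 0)" for x :: "real ^ 3"
    using perm by (rule three_perm_cases) (auto simp: vec_eq_iff forall_3)
  have ex: "\<exists>x :: real ^ 3. x $ i = a \<and> x $ j = b \<and> x $ k = c" for a b c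
    using perm
    by (intro exI[of _ "\<chi> m. if m = i then a else if m = j then b else c"], rule three_perm_cases) auto
  show ?thesis
    unfolding positive_definite_tensor_def quartic_pd_def nz tensor_form_eq_quartic_form[OF t adm]
    using ex by metis
qed

section \<open>Sign changes and reversal of the variables\<close>

text \<open>Substituting \<open>(s1 * x, y, s2 * z)\<close> permutes the nonzero points; a monomial
  gains \<open>s1\<close> if it is odd in \<open>x\<close> and \<open>s2\<close> if it is odd in
  \<open>z\<close>.\<close>

lemma quartic_pd_sign_flip:
  assumes "s1 \<in> {-1, 1}" "s2 \<in> {-1, 1}"
  shows "quartic_pd a b c d u v w p q r \<longleftrightarrow>
    quartic_pd (s1 * a) (s1 * b) (s2 * c) (s2 * d) u v w (s2 * p) (s1 * s2 * q) (s1 * r)"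
    (is "_ \<longleftrightarrow> quartic_pd ?a ?b ?c ?d u v w ?p ?q ?r")
proof -
  have eq: "quartic_form ?a ?b ?c ?d u v w ?p ?q ?r x y z =
      quartic_form a b c d u v w p q r (s1 * x) y (s2 * z)" for x y z
    using assms by (auto simp: quartic_form_def algebra_simps)
  have invol: "s1 * (s1 * x) = x" "s2 * (s2 * x) = x" for x
    using assms by auto
  have nz: "s1 \<noteq> 0" "s2 \<noteq> 0"
    using assms by auto
  show ?thesis
  proof
    assume "quartic_pd a b c d u v w p q r"
    then show "quartic_pd ?a ?b ?c ?d u v w ?p ?q ?r"
      unfolding quartic_pd_def eq using nz by simp
  next
    assume pd: "quartic_pd ?a ?b ?c ?d u v w ?p ?q ?r"
    show "quartic_pd a b c d u v w p q r"
      unfolding quartic_pd_def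
    proof (intro allI impI)
      fix x y z :: real
      assume "(x, y, z) \<noteq> (0, 0, 0)"
      then have "(s1 * x, y, s2 * z) \<noteq> (0, 0, 0)" using nz by simp
      then show "0 < quartic_form a b c d u v w p q r x y z"
        using pd unfolding quartic_pd_def eq by (metis invol)
    qed
  qed
qed

text \<open>Exchanging \<open>x\<close> and \<open>z\<close> maps shape A to itself with
  \<open>p\<close> and \<open>r\<close> swapped, so one certificate of that shape serves two
  cases.\<close>

lemma quartic_pd_reverse:
  "quartic_pd a b c d u v w p q r \<longleftrightarrow> quartic_pd d c b a v u w r q p"
proof -
  have "quartic_form d c b a v u w r q p x y z = quartic_form a b c d u v w p q r z y x" for x y z
    by (simp add: quartic_form_def algebra_simps)
  then show ?thesis
    unfolding quartic_pd_def by auto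
qed

section \<open>Sum-of-squares certificates\<close>

text \<open>The term with \<open>e\<close> supplies strictness, so \<open>S\<close> may have
  nontrivial zeros.\<close>

lemma quartic_pdI:
  assumes "\<And>x y z. quartic_form a b c d u v w p q r x y z = e * (x^4 + y^4 + z^4) + S x y z"
    and "\<And>x y z. S x y z \<ge> 0" and "e > 0"
  shows "quartic_pd a b c d u v w p q r"
  unfolding quartic_pd_def
proof (intro allI impI)
  fix x y z :: real
  assume "(x, y, z) \<noteq> (0, 0, 0)"
  then have "x^4 + y^4 + z^4 > 0" by (auto simp: add_pos_nonneg add_nonneg_pos)
  then have "e * (x^4 + y^4 + z^4) > 0" using assms(3) by simp
  then show "quartic_form a b c d u v w p q r x y z > 0"
    using assms(1,2)[of x y z] by linarith
qed

text \<open>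
  The letters A, B, C refer to the conditions (a), (b), (c). The sums of squares are \<open>LDL\<^sup>T\<close>
  decompositions of positive semidefinite rational Gram matrices, rounded from numerical solutions.
\<close>

lemma quartic_pd_A_base:
  assumes "w \<ge> 0"
  shows "quartic_pd 1 0 0 1 1 1 w 0 0 0"
proof (rule quartic_pdI)
  fix x y z :: real
  show "quartic_form 1 0 0 1 1 1 w 0 0 0 x y z = 1/3 * (x^4 + y^4 + z^4) +
      (2/3 * (3 * x * y + x^2)^2 + 2/3 * (y^2)^2 + 2/3 * (3 * y * z + z^2)^2 + 6 * w * (x * z)^2)"
    unfolding quartic_form_def by algebra
qed (use assms in simp_all)

text \<open>Each cubic term is the cross term of one completed square, which also uses up
  \<open>6 * x^2 * y^2\<close> or \<open>6 * y^2 * z^2\<close>; \<open>w\<close> enters only through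
  \<open>(x * z)^2\<close>.\<close>

lemma quartic_pd_B_base:
  assumes "w \<ge> 0"
  shows "quartic_pd 1 0 1 0 1 1 w 0 0 0"
proof (rule quartic_pdI)
  fix x y z :: real
  show "quartic_form 1 0 1 0 1 1 w 0 0 0 x y z = 1/3 * (x^4 + y^4 + z^4) +
      (2/3 * (3 * x * y + x^2)^2 + 2/3 * (3 * y * z + y^2)^2 + 2/3 * (z^2)^2 + 6 * w * (x * z)^2)"
    unfolding quartic_form_def by algebra
qed (use assms in simp_all)

text \<open>The square of \<open>y * (3 * x + y + 3 * z)\<close> yields both cubic terms and also
  \<open>12 * x * y^2 * z\<close>, which accounts for \<open>q = 1\<close>.\<close>

lemma quartic_pd_C_base:
  assumes "w \<ge> 0"
  shows "quartic_pd 0 1 1 0 1 1 w 0 1 0"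
proof (rule quartic_pdI)
  fix x y z :: real
  show "quartic_form 0 1 1 0 1 1 w 0 1 0 x y z = 1/3 * (x^4 + y^4 + z^4) +
      (2/3 * (3 * x * y + y^2 + 3 * y * z)^2 + 2/3 * (x^2)^2 + 2/3 * (z^2)^2 + 6 * w * (x * z)^2)"
    unfolding quartic_form_def by algebra
qed (use assms in simp_all)

text \<open>The suffix of the name gives the signs of the nonzero coefficients among
  \<open>p\<close>, \<open>q\<close>, \<open>r\<close>. In the shapes A and B such a coefficient is
  compatible only with \<open>w = 1\<close>.\<close>

lemma quartic_pd_A_plus: "quartic_pd 1 0 0 1 1 1 1 0 1 0"
proof (rule quartic_pdI)
  fix x y z :: real
  show "quartic_form 1 0 0 1 1 1 1 0 1 0 x y z = 1/5 * (x^4 + y^4 + z^4) +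
     (1/20 * (4 * y^2 + 5 * x * z)^2
      + 3/20 * (5 * x * z - 2 * x * y - 2 * y * z)^2
      + 1/540 * (54 * x * y + 44 * y * z + 20 * x^2 + 15 * z^2)^2
      + 1/108 * (14 * y * z - x^2 + 6 * z^2)^2
      + 1/20 * (x^2)^2
      + 1/20 * (z^2)^2)"
    unfolding quartic_form_def by algebra
qed simp_all

lemma quartic_pd_A_minus: "quartic_pd 1 0 0 1 1 1 1 0 (-1) 0"
proof (rule quartic_pdI)
  fix x y z :: real
  show "quartic_form 1 0 0 1 1 1 1 0 (-1) 0 x y z = 1/30 * (x^4 + y^4 + z^4) +
     (1/24 * (12 * x * y + 4 * x^2 - 9 * y * z - 3 * z^2 + 3 * x * z)^2
      + 1/30 * (3 * x^2 - 5 * x * z)^2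
      + 7/24 * (3 * y * z + z^2 + 3 * x * z)^2
      + 1/30 * (3 * z^2 - 5 * x * z)^2
      + 1/84 * (14 * x * z - 9 * y^2)^2
      + 1/420 * (y^2)^2)"
    unfolding quartic_form_def by algebra
qed simp_all

lemma quartic_pd_A_minus_minus: "quartic_pd 1 0 0 1 1 1 1 (-1) (-1) 0"
proof (rule quartic_pdI)
  fix x y z :: real
  show "quartic_form 1 0 0 1 1 1 1 (-1) (-1) 0 x y z = 1/30 * (x^4 + y^4 + z^4) +
     (1/870 * (29 * y^2 - 10 * x^2 - 30 * x * z)^2
      + 1/54 * (18 * y * z + 6 * z^2 - 15 * x * y - 6 * x^2 + 4 * x * z)^2
      + 1/2430 * (27 * z^2 + 30 * x * y - 40 * x * z)^2
      + 1/55890 * (345 * x * y + 54 * x^2 - 388 * x * z)^2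
      + 1/478859310 * (7977 * x^2 + 28484 * x * z)^2
      + 343252/358965 * (x * z)^2)"
    unfolding quartic_form_def by algebra
qed simp_all

lemma quartic_pd_B_plus: "quartic_pd 1 0 1 0 1 1 1 0 0 1"
proof (rule quartic_pdI)
  fix x y z :: real
  show "quartic_form 1 0 1 0 1 1 1 0 0 1 x y z = 1/16 * (x^4 + y^4 + z^4) +
     (1/240 * (15 * y^2 + 24 * x * z + 32 * y * z)^2
      + 1/240 * (15 * z^2 + 24 * x * y + 8 * x^2)^2
      + 1/260 * (26 * x * z + 13 * y * z + 5 * x * y)^2
      + 1/156 * (13 * y * z - 21 * x * y - 6 * x^2)^2
      + 1/11440 * (88 * x * y + 51 * x^2)^2
      + 365/1716 * (x^2)^2)"
    unfolding quartic_form_def by algebra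
qed simp_all

lemma quartic_pd_B_minus: "quartic_pd 1 0 1 0 1 1 1 0 0 (-1)"
proof (rule quartic_pdI)
  fix x y z :: real
  show "quartic_form 1 0 1 0 1 1 1 0 0 (-1) x y z = 1/5 * (x^4 + y^4 + z^4) +
     (1/80 * (8 * y^2 + 20 * y * z - 15 * x * z)^2
      + 1/80 * (8 * z^2 - 15 * x * y - 5 * x^2)^2
      + 1/816 * (51 * x * y + 17 * x^2 + 24 * y * z - 8 * x * z)^2
      + 1/120 * (4 * x^2 + 5 * x * z)^2
      + 5/272 * (4 * y * z - 7 * x * z)^2
      + 3 * (x * z)^2)"
    unfolding quartic_form_def by algebra
qed simp_all

lemma quartic_pd_B_minus_minus: "quartic_pd 1 0 1 0 1 1 1 0 (-1) (-1)"
proof (rule quartic_pdI)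
  fix x y z :: real
  show "quartic_form 1 0 1 0 1 1 1 0 (-1) (-1) x y z = 1/60 * (x^4 + y^4 + z^4) +
     (1/14160 * (118 * z^2 - 45 * y^2 - 135 * x * y - 45 * x^2)^2
      + 1/432 * (54 * x * z - 17 * y^2 + 9 * x * y - 39 * y * z)^2
      + 1/2782779840 * (21836 * y^2 - 9540 * x * y + 59295 * y * z - 2295 * x^2)^2
      + 1/180044 * (874 * x * y - 589 * y * z + 322 * x^2)^2
      + 7/33780928 * (433 * y * z - 253 * x^2)^2
      + 123053/493620 * (x^2)^2)"
    unfolding quartic_form_def by algebra
qed simp_all

lemma quartic_pd_C_plus: "quartic_pd 0 1 1 0 1 1 1 1 1 1"
proof (rule quartic_pdI)
  fix x y z :: real
  show "quartic_form 0 1 1 0 1 1 1 1 1 1 x y z = 1/12 * (x^4 + y^4 + z^4) +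
     (1/28 * (14 * x * z + 5 * y^2 + 11 * x * y + 11 * y * z)^2
      + 1/168 * (2 * y^2 + 3 * x * y + 3 * y * z)^2
      + 1/104 * (13 * x * y - 7 * y * z + 4 * z^2)^2
      + 1/780 * (30 * y * z + 13 * x^2 + 7 * z^2)^2
      + 1/2520 * (42 * x^2 - 37 * z^2)^2
      + 79/504 * (z^2)^2)"
    unfolding quartic_form_def by algebra
qed simp_all

section \<open>Classification of the positive definite forms of each shape\<close>

lemma quartic_pdD:
  assumes "quartic_pd a b c d u v w p q r" "(x, y, z) \<noteq> (0, 0, 0)"
  shows "quartic_form a b c d u v w p q r x y z > 0"
  using assms unfolding quartic_pd_def by blast

lemma quartic_pd_A_iff:
  assumes uvw: "u \<in> {-1, 0, 1}" "v \<in> {-1, 0, 1}" "w \<in> {-1, 0, 1}"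
    and pqr: "p \<in> {-1, 0, 1}" "q \<in> {-1, 0, 1}" "r \<in> {-1, 0, 1}"
  shows "quartic_pd 1 0 0 1 u v w p q r \<longleftrightarrow> u = 1 \<and> v = 1 \<and>
    (p = 0 \<and> q = 0 \<and> r = 0 \<and> w \<in> {0, 1}
     \<or> w = 1 \<and> q \<in> {-1, 1} \<and> p = 0 \<and> r = 0
     \<or> w = 1 \<and> q = -1 \<and> (p = -1 \<and> r = 0 \<or> p = 0 \<and> r = -1))"
proof
  assume pd: "quartic_pd 1 0 0 1 u v w p q r"
  note D = quartic_pdD[OF pd, unfolded quartic_form_def]
  \<comment> \<open>On the coordinate planes the terms with \<open>p\<close>, \<open>q\<close>,
    \<open>r\<close> vanish. The three points give \<open>24 * u - 15 > 0\<close>,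
    \<open>24 * v - 15 > 0\<close> and \<open>2 + 6 * w > 0\<close>.\<close>
  have u: "u = 1" using D[of 2 "-1" 0] uvw(1) by auto
  have v: "v = 1" using D[of 0 "-1" 2] uvw(2) by auto
  have w: "w = 0 \<or> w = 1" using D[of 1 0 1] uvw(3) by auto
  \<comment> \<open>Of the 54 choices of \<open>(w, p, q, r)\<close> that remain, every one not
    listed makes the form nonpositive at one of the five points.\<close>
  show "u = 1 \<and> v = 1 \<and>
    (p = 0 \<and> q = 0 \<and> r = 0 \<and> w \<in> {0, 1}
     \<or> w = 1 \<and> q \<in> {-1, 1} \<and> p = 0 \<and> r = 0
     \<or> w = 1 \<and> q = -1 \<and> (p = -1 \<and> r = 0 \<or> p = 0 \<and> r = -1))"
    using w pqr D[of 3 "-2" 4, simplified] D[of 1 2 "-4", simplified] D[of 2 "-1" "-1", simplified]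
      D[of 1 1 1, simplified] D[of 2 "-1" 1, simplified]
    unfolding u v by (elim disjE insertE emptyE; simp)
next
  have rev: "quartic_pd 1 0 0 1 1 1 1 0 (-1) (-1)"
    using quartic_pd_A_minus_minus quartic_pd_reverse by blast
  assume "u = 1 \<and> v = 1 \<and>
    (p = 0 \<and> q = 0 \<and> r = 0 \<and> w \<in> {0, 1}
     \<or> w = 1 \<and> q \<in> {-1, 1} \<and> p = 0 \<and> r = 0
     \<or> w = 1 \<and> q = -1 \<and> (p = -1 \<and> r = 0 \<or> p = 0 \<and> r = -1))"
  then show "quartic_pd 1 0 0 1 u v w p q r"
    using rev quartic_pd_A_base[of w] quartic_pd_A_plus quartic_pd_A_minus quartic_pd_A_minus_minus
    by auto
qed

text \<open>Reversal sends the pattern \<open>1 0 1 0\<close> to \<open>0 1 0 1\<close>, not to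
  itself, so \<open>p\<close> and \<open>r\<close> play different roles here, unlike in shape
  A.\<close>

lemma quartic_pd_B_iff:
  assumes uvw: "u \<in> {-1, 0, 1}" "v \<in> {-1, 0, 1}" "w \<in> {-1, 0, 1}"
    and pqr: "p \<in> {-1, 0, 1}" "q \<in> {-1, 0, 1}" "r \<in> {-1, 0, 1}"
  shows "quartic_pd 1 0 1 0 u v w p q r \<longleftrightarrow> u = 1 \<and> v = 1 \<and>
    (p = 0 \<and> q = 0 \<and> r = 0 \<and> w \<in> {0, 1}
     \<or> w = 1 \<and> r \<in> {-1, 1} \<and> p = 0 \<and> q = 0
     \<or> w = 1 \<and> q = -1 \<and> r = -1 \<and> p = 0)"
proof
  assume pd: "quartic_pd 1 0 1 0 u v w p q r"
  note D = quartic_pdD[OF pd, unfolded quartic_form_def]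
  have u: "u = 1" using D[of 2 "-1" 0] uvw(1) by auto
  have v: "v = 1" using D[of 0 "-2" 1] uvw(2) by auto
  have w: "w = 0 \<or> w = 1" using D[of 1 0 1] uvw(3) by auto
  show "u = 1 \<and> v = 1 \<and>
    (p = 0 \<and> q = 0 \<and> r = 0 \<and> w \<in> {0, 1}
     \<or> w = 1 \<and> r \<in> {-1, 1} \<and> p = 0 \<and> q = 0
     \<or> w = 1 \<and> q = -1 \<and> r = -1 \<and> p = 0)"
    using w pqr D[of 2 "-1" "-1", simplified] D[of 3 "-2" 1, simplified] D[of 1 2 "-1", simplified]
      D[of 1 1 1, simplified] D[of 1 1 "-2", simplified] D[of 1 "-4" 2, simplified]
      D[of 5 "-2" "-1", simplified]
    unfolding u v by (elim disjE insertE emptyE; simp)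
next
  assume "u = 1 \<and> v = 1 \<and>
    (p = 0 \<and> q = 0 \<and> r = 0 \<and> w \<in> {0, 1}
     \<or> w = 1 \<and> r \<in> {-1, 1} \<and> p = 0 \<and> q = 0
     \<or> w = 1 \<and> q = -1 \<and> r = -1 \<and> p = 0)"
  then show "quartic_pd 1 0 1 0 u v w p q r"
    using quartic_pd_B_base[of w] quartic_pd_B_plus quartic_pd_B_minus quartic_pd_B_minus_minus
    by auto
qed

lemma quartic_pd_C_iff:
  assumes uvw: "u \<in> {-1, 0, 1}" "v \<in> {-1, 0, 1}" "w \<in> {-1, 0, 1}"
    and pqr: "p \<in> {-1, 0, 1}" "q \<in> {-1, 0, 1}" "r \<in> {-1, 0, 1}"
  shows "quartic_pd 0 1 1 0 u v w p q r \<longleftrightarrow> u = 1 \<and> v = 1 \<and> q = 1 \<and>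
    (p = 1 \<and> r = 1 \<and> w = 1 \<or> p = 0 \<and> r = 0 \<and> w \<in> {0, 1})"
proof
  assume pd: "quartic_pd 0 1 1 0 u v w p q r"
  note D = quartic_pdD[OF pd, unfolded quartic_form_def]
  have u: "u = 1" using D[of 1 "-2" 0] uvw(1) by auto
  have v: "v = 1" using D[of 0 "-2" 1] uvw(2) by auto
  have w: "w = 0 \<or> w = 1" using D[of 1 0 1] uvw(3) by auto
  \<comment> \<open>The point (1, -4, 1) leaves \<open>q = 1\<close>, or \<open>q = 0\<close> with
    \<open>p = r = -1\<close>, which (3, 2, 3) rejects. For \<open>q = 1\<close>, the points (1, -1,
    -1) and (1, 3, -2) give \<open>r <= p <= 2 * r\<close>, so \<open>p = r\<close> is 0 or 1; (1,
    -1, 1) rejects 1 when \<open>w = 0\<close>.\<close>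
  show "u = 1 \<and> v = 1 \<and> q = 1 \<and>
    (p = 1 \<and> r = 1 \<and> w = 1 \<or> p = 0 \<and> r = 0 \<and> w \<in> {0, 1})"
    using w pqr D[of 1 "-4" 1, simplified] D[of 1 3 "-2", simplified] D[of 1 "-1" "-1", simplified]
      D[of 3 2 3, simplified] D[of 1 "-1" 1, simplified]
    unfolding u v by (elim disjE insertE emptyE; simp)
next
  assume "u = 1 \<and> v = 1 \<and> q = 1 \<and>
    (p = 1 \<and> r = 1 \<and> w = 1 \<or> p = 0 \<and> r = 0 \<and> w \<in> {0, 1})"
  then show "quartic_pd 0 1 1 0 u v w p q r"
    using quartic_pd_C_base[of w] quartic_pd_C_plus by auto
qed

section \<open>Translation into the tensor conditions\<close>

text \<open>Relabelling permutes the three mixed entries among themselves. This turns clauses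
  written with 1, 2, 3 into clauses in \<open>i\<close>, \<open>j\<close>, \<open>k\<close>, the
  indices of the quartic.\<close>

lemma mixed_zero_perm:
  assumes "symmetric_tensor t" "mset [i, j, k] = mset [1, 2, 3]"
  shows "t 1 1 2 3 = 0 \<and> t 1 2 2 3 = 0 \<and> t 1 2 3 3 = 0 \<longleftrightarrow>
    t i i j k = 0 \<and> t i j j k = 0 \<and> t i j k k = 0"
  using assms(2) by (rule three_perm_cases) (auto simp: symmetric_tensor_swap[OF assms(1)])

lemma squares_one_perm:
  assumes "symmetric_tensor t" "mset [i, j, k] = mset [1, 2, 3]"
  shows "t 1 1 2 2 = 1 \<and> t 2 2 3 3 = 1 \<and> t 1 1 3 3 = 1 \<longleftrightarrow>
    t i i j j = 1 \<and> t j j k k = 1 \<and> t i i k k = 1"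
  using assms(2) by (rule three_perm_cases) (auto simp: symmetric_tensor_swap[OF assms(1)])

lemma E_hat_43_entry: "t \<in> E_hat_43 \<Longrightarrow> t i j k l \<in> {-1, 0, 1}"
  unfolding E_hat_43_def by blast

lemma sign_times_entry:
  fixes s e :: real
  assumes "s \<in> {-1, 1}" "e \<in> {-1, 0, 1}"
  shows "s * e \<in> {-1, 0, 1}"
  using assms by auto

lemma condition_a_iff:
  assumes t: "t \<in> E_hat_43" and adm: "admissible t i j k"
  shows "condition_a t i j k \<longleftrightarrow>
    t i i i j \<noteq> 0 \<and> t j k k k \<noteq> 0 \<and> positive_definite_tensor t"
proof (cases "t i i i j \<noteq> 0 \<and> t j k k k \<noteq> 0")
  case False
  then show ?thesis unfolding condition_a_def by auto
next
  case True
  have sym: "symmetric_tensor t" and perm: "mset [i, j, k] = mset [1, 2, 3]"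
    using t adm by (auto simp: E_hat_43_def admissible_def)
  note ent = E_hat_43_entry[OF t]
  have z: "t i j j j = 0" "t j j j k = 0"
    using adm True by (auto simp: admissible_def)
  define s1 s2 where "s1 = t i i i j" and "s2 = t j k k k"
  have s: "s1 \<in> {-1, 1}" "s2 \<in> {-1, 1}"
    using True ent[of i i i j] ent[of j k k k] by (auto simp: s1_def s2_def)
  then have s12: "s1 * s2 \<in> {-1, 1}" and sq: "s1 * s1 = 1" "s2 * s2 = 1" by auto
  have alt: "condition_a t i j k \<longleftrightarrow>
      ((t i i j k = 0 \<and> t i j j k = 0 \<and> t i j k k = 0 \<and> t i i k k \<in> {0, 1}
          \<and> t i i j j = 1 \<and> t j j k k = 1)
       \<or> (t i j j k \<in> {-1, 1} \<and> t i i j k = 0 \<and> t i j k k = 0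
          \<and> t i i j j = 1 \<and> t j j k k = 1 \<and> t i i k k = 1)
       \<or> (t i i j j = 1 \<and> t j j k k = 1 \<and> t i i k k = 1
          \<and> - (s1 * s2 * t i j j k) = 1
          \<and> (t i i j k * s2 = -1 \<and> t i j k k = 0
             \<or> t i j k k * s1 = -1 \<and> t i i j k = 0)))"
    unfolding condition_a_def s1_def[symmetric] s2_def[symmetric]
    using s mixed_zero_perm[OF sym perm] squares_one_perm[OF sym perm] by argo
  \<comment> \<open>Flipping by \<open>s1\<close> and \<open>s2\<close> turns the two nonzero cubic
    coefficients into their squares, which are 1. The products in the third clause of the condition
    are the flipped \<open>p\<close>, \<open>q\<close>, \<open>r\<close>.\<close>
  have "positive_definite_tensor t \<longleftrightarrow>
      quartic_pd 1 0 0 1 (t i i j j) (t j j k k) (t i i k k) (s2 * t i i j k) (s1 * s2 * t i j j k) (s1 * t i j k k)"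
    using tensor_pd_iff_quartic_pd[OF t adm] quartic_pd_sign_flip[OF s, of s1 0 0 s2]
    by (simp add: z sq flip: s1_def s2_def)
  also have "\<dots> \<longleftrightarrow> condition_a t i j k"
    unfolding quartic_pd_A_iff[OF ent ent ent sign_times_entry[OF s(2) ent] sign_times_entry[OF s12 ent] sign_times_entry[OF s(1) ent]]
      alt
    using s by (elim insertE emptyE; simp; argo)
  finally show ?thesis using True by simp
qed

lemma condition_b_iff:
  assumes t: "t \<in> E_hat_43" and adm: "admissible t i j k"
  shows "condition_b t i j k \<longleftrightarrow>
    t i i i j \<noteq> 0 \<and> t j j j k \<noteq> 0 \<and> positive_definite_tensor t"
proof (cases "t i i i j \<noteq> 0 \<and> t j j j k \<noteq> 0")
  case False
  then show ?thesis unfolding condition_b_def by auto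
next
  case True
  have sym: "symmetric_tensor t" and perm: "mset [i, j, k] = mset [1, 2, 3]"
    using t adm by (auto simp: E_hat_43_def admissible_def)
  note ent = E_hat_43_entry[OF t]
  have z: "t i j j j = 0" "t j k k k = 0"
    using adm True by (auto simp: admissible_def)
  define s1 s2 where "s1 = t i i i j" and "s2 = t j j j k"
  have s: "s1 \<in> {-1, 1}" "s2 \<in> {-1, 1}"
    using True ent[of i i i j] ent[of j j j k] by (auto simp: s1_def s2_def)
  then have s12: "s1 * s2 \<in> {-1, 1}" and sq: "s1 * s1 = 1" "s2 * s2 = 1" by auto
  have alt: "condition_b t i j k \<longleftrightarrow>
      ((t i i j k = 0 \<and> t i j j k = 0 \<and> t i j k k = 0 \<and> t i i k k \<in> {0, 1}
          \<and> t i i j j = 1 \<and> t j j k k = 1)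
       \<or> (t i j k k \<in> {-1, 1} \<and> t i i j k = 0 \<and> t i j j k = 0
          \<and> t i i j j = 1 \<and> t j j k k = 1 \<and> t i i k k = 1)
       \<or> (t i i j j = 1 \<and> t j j k k = 1 \<and> t i i k k = 1
          \<and> - (s1 * s2 * t i j j k) = 1
          \<and> - (t i j k k * s1) = 1 \<and> t i i j k = 0))"
    unfolding condition_b_def s1_def[symmetric] s2_def[symmetric]
    using s mixed_zero_perm[OF sym perm] squares_one_perm[OF sym perm] by argo
  have "positive_definite_tensor t \<longleftrightarrow>
      quartic_pd 1 0 1 0 (t i i j j) (t j j k k) (t i i k k) (s2 * t i i j k) (s1 * s2 * t i j j k) (s1 * t i j k k)"
    using tensor_pd_iff_quartic_pd[OF t adm] quartic_pd_sign_flip[OF s, of s1 0 s2 0]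
    by (simp add: z sq flip: s1_def s2_def)
  also have "\<dots> \<longleftrightarrow> condition_b t i j k"
    unfolding quartic_pd_B_iff[OF ent ent ent sign_times_entry[OF s(2) ent] sign_times_entry[OF s12 ent] sign_times_entry[OF s(1) ent]]
      alt
    using s by (elim insertE emptyE; simp; argo)
  finally show ?thesis using True by simp
qed

text \<open>After the sign flip, the requirement common to both clauses is exactly
  \<open>q = 1\<close>, which every positive definite form of shape C satisfies.\<close>

lemma condition_c_iff:
  assumes t: "t \<in> E_hat_43" and adm: "admissible t i j k"
  shows "condition_c t i j k \<longleftrightarrow>
    t i j j j \<noteq> 0 \<and> t j j j k \<noteq> 0 \<and> positive_definite_tensor t"
proof (cases "t i j j j \<noteq> 0 \<and> t j j j k \<noteq> 0")
  case False
  then show ?thesis unfolding condition_c_def by auto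
next
  case True
  have sym: "symmetric_tensor t" and perm: "mset [i, j, k] = mset [1, 2, 3]"
    using t adm by (auto simp: E_hat_43_def admissible_def)
  note ent = E_hat_43_entry[OF t]
  have z: "t i i i j = 0" "t j k k k = 0"
    using adm True by (auto simp: admissible_def)
  define s1 s2 where "s1 = t i j j j" and "s2 = t j j j k"
  have s: "s1 \<in> {-1, 1}" "s2 \<in> {-1, 1}"
    using True ent[of i j j j] ent[of j j j k] by (auto simp: s1_def s2_def)
  then have s12: "s1 * s2 \<in> {-1, 1}" and sq: "s1 * s1 = 1" "s2 * s2 = 1" by auto
  have "positive_definite_tensor t \<longleftrightarrow>
      quartic_pd 0 1 1 0 (t i i j j) (t j j k k) (t i i k k) (s2 * t i i j k) (s1 * s2 * t i j j k) (s1 * t i j k k)"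
    using tensor_pd_iff_quartic_pd[OF t adm] quartic_pd_sign_flip[OF s, of 0 s1 s2 0]
    by (simp add: z sq flip: s1_def s2_def)
  also have "\<dots> \<longleftrightarrow> condition_c t i j k"
    unfolding quartic_pd_C_iff[OF ent ent ent sign_times_entry[OF s(2) ent] sign_times_entry[OF s12 ent] sign_times_entry[OF s(1) ent]]
      condition_c_def s1_def[symmetric] s2_def[symmetric]
    using s squares_one_perm[OF sym perm] by auto
  finally show ?thesis using True by simp
qed

section \<open>The remaining pattern and the conclusion\<close>

text \<open>The pattern with \<open>t i j j j\<close> and \<open>t j k k k\<close> nonzero fits none
  of the three conditions at \<open>(i, j, k)\<close>; read along \<open>(k, j, i)\<close> it is the
  pattern of \<open>condition_b\<close>.\<close>

lemma admissible_reverse: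
  assumes sym: "symmetric_tensor t" and adm: "admissible t i j k"
  shows "admissible t k j i" "t k k k j = t j k k k" "t j j j i = t i j j j"
proof -
  note sw = symmetric_tensor_swap[OF sym]
  have eqs: "t k k k j = t j k k k" "t k j j j = t j j j k" "t j j j i = t i j j j"
    "t j i i i = t i i i j" "t k k k i = t i k k k" "t k i i i = t i i i k"
    by (simp_all only: sw)
  show "t k k k j = t j k k k" "t j j j i = t i j j j" by (fact eqs)+
  show "admissible t k j i"
    using adm unfolding admissible_def eqs
    by (auto simp: add_mset_commute mult.commute add.commute)
qed

theorem theorem3p5:
  fixes t :: "3 \<Rightarrow> 3 \<Rightarrow> 3 \<Rightarrow> 3 \<Rightarrow> real"
  assumes "t \<in> E_hat_43"
    and "\<exists>i j k. admissible t i j k"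
  shows "positive_definite_tensor t \<longleftrightarrow>
    (\<exists>i j k. admissible t i j k \<and>
       (condition_a t i j k \<or> condition_b t i j k \<or> condition_c t i j k))"
proof -
  obtain i j k where adm: "admissible t i j k" using assms(2) by blast
  have sym: "symmetric_tensor t" using assms(1) by (simp add: E_hat_43_def)
  note rev = admissible_reverse[OF sym adm]
  note iffs = condition_a_iff[OF assms(1)] condition_b_iff[OF assms(1)] condition_c_iff[OF assms(1)]
  \<comment> \<open>This yields four patterns of nonzero cubic entries. Three are settled by the
    equivalences at \<open>(i, j, k)\<close>, the fourth by that for \<open>condition_b\<close> at
    \<open>(k, j, i)\<close>; conversely, each condition at any admissible permutation implies
    positive definiteness.\<close>
  have "(t i i i j \<noteq> 0 \<or> t i j j j \<noteq> 0) \<and> (t j j j k \<noteq> 0 \<or> t j k k k \<noteq> 0)"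
    using adm by (auto simp: admissible_def)
  then show ?thesis
    using iffs adm rev by metis
qed

end
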